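(* Let $w$ be a positive integer, let $n=w+3$, and let $k$ denote the number of a row, $1\le k\le \lfloor w/2\rfloor$. (a) Let $v=(v_{i,j})$ and $u=(u_{i,j})$ be two frieze patterns of the same width $w$ whose non-trivial entries are positive real numbers. If $k=1$ or $k=2$, then the cyclic ($n$-periodic) sequence of differences of the entries of the $k$th rows $$v_{i,i+k+1}-u_{i,i+k+1}$$ must have at least four sign changes over the period. (b) For every $k$, the same holds in the infinitesimal version of the problem: if $(\dot v_{i,j})$ is an infinitesimal deformation, in the class of frieze patterns of width $w$, of the constant frieze pattern $$v^0_{i,j}=\frac{\sin\frac{(j-i)\pi}{n}}{\sin\frac{\pi}{n}},$$ then the cyclic ($n$-periodic) sequence $\dot v_{i,i+k+1}$ of infinitesimal variations of the entries of the $k$th row must have at least four sign changes over the period.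
   Context: Frieze patterns. Let $w\ge 1$ and $n=w+3$. A frieze pattern of width $w$ is an array of numbers $v_{i,j}$, indexed by integers $i,j$ with $i\le j\le i+n$, such that for all $i$ $$v_{i,i}=0,\quad v_{i,i+1}=1,\quad v_{i,i+n-1}=1,\quad v_{i,i+n}=0,$$ and the unimodular relation $$v_{i,j-1}\,v_{i+1,j}-v_{i,j}\,v_{i+1,j-1}=1$$ holds for all $i$ and all $j$ with $i+2\le j\le i+n$. (Written as an array of bi-infinite rows, each offset by half a step from the previous one: the top two rows consist of 0s and of 1s, the bottom two rows consist of 1s and of 0s, and every elementary diamond with entries $N,W,E,S$ satisfies $EW-NS=1$.) The $k$th non-trivial row, $1\le k\le w$, consists of the entries $v_{i,i+k+1}$, $i\in\mathbb Z$; these are the non-trivial entries. Frieze patterns have the glide symmetry $v_{i,j}=v_{j,i+n}$; in particular each row is $n$-periodic in $i$, and only rows with $k\le\lfloor w/2\rfloor$ need to be considered. Constant frieze pattern. The array $v^0_{i,j}=\sin\frac{(j-i)\pi}{n}/\sin\frac{\pi}{n}$ is the frieze pattern of width $w$ whose first row is the constant $2\cos(\pi/n)$; every row of it is constant. Infinitesimal deformation. An infinitesimal deformation of $v^0$ in the class of frieze patterns is a real array $(\dot v_{i,j})_{i\le j\le i+n}$ such that the array $v^0_{i,j}+\varepsilon\,\dot v_{i,j}$, with $\varepsilon^2=0$, satisfies all the defining conditions of a frieze pattern of width $w$. Its rows are again $n$-periodic in $i$. Sign changes. For an $n$-periodic real sequence $d_i$, one counts the sign changes of $d_i$ as $i$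 increases by 1, over one period, not excluding the case when either of the two consecutive terms vanishes; that is, a sign change from $i$ to $i+1$ means $d_i d_{i+1}\le 0$. *)

theory Defs
  imports Complex_Main
begin

text \<open>Dual numbers: \<open>Dual a b\<close> stands for \<open>a + b \<epsilon>\<close> with \<open>\<epsilon>\<^sup>2 = 0\<close>.\<close>

datatype dual = Dual (std_part: real) (eps_part: real)

instantiation dual :: comm_ring_1
begin

definition zero_dual :: dual where "0 = Dual 0 0"
definition one_dual :: dual where "1 = Dual 1 0"
definition plus_dual :: "dual \<Rightarrow> dual \<Rightarrow> dual" where
  "x + y = Dual (std_part x + std_part y) (eps_part x + eps_part y)"
definition minus_dual :: "dual \<Rightarrow> dual \<Rightarrow> dual" where
  "x - y = Dual (std_part x - std_part y) (eps_part x - eps_part y)"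
definition uminus_dual :: "dual \<Rightarrow> dual" where
  "- x = Dual (- std_part x) (- eps_part x)"
definition times_dual :: "dual \<Rightarrow> dual \<Rightarrow> dual" where
  "x * y = Dual (std_part x * std_part y) (std_part x * eps_part y + eps_part x * std_part y)"

instance
  by standard
    (auto simp: zero_dual_def one_dual_def plus_dual_def minus_dual_def uminus_dual_def
      times_dual_def algebra_simps)

end

text \<open>Arrays are total functions on pairs of integers, but every condition below only
  mentions entries \<open>v i j\<close> with \<open>i \<le> j \<le> i + n\<close>, where \<open>n = w + 3\<close>; the remaining values
  are irrelevant.\<close>

definition frieze :: "nat \<Rightarrow> (int \<Rightarrow> int \<Rightarrow> 'a::comm_ring_1) \<Rightarrow> bool" where
  "frieze w v \<longleftrightarrow>
    (let n = int w + 3 in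
      (\<forall>i. v i i = 0 \<and> v i (i + 1) = 1 \<and> v i (i + n - 1) = 1 \<and> v i (i + n) = 0) \<and>
      (\<forall>i j. i + 2 \<le> j \<and> j \<le> i + n \<longrightarrow>
        v i (j - 1) * v (i + 1) j - v i j * v (i + 1) (j - 1) = 1))"

definition frieze_row :: "(int \<Rightarrow> int \<Rightarrow> 'a) \<Rightarrow> nat \<Rightarrow> int \<Rightarrow> 'a" where
  "frieze_row v k i = v i (i + int k + 1)"

definition positive_frieze :: "nat \<Rightarrow> (int \<Rightarrow> int \<Rightarrow> real) \<Rightarrow> bool" where
  "positive_frieze w v \<longleftrightarrow> frieze w v \<and> (\<forall>k\<in>{1..w}. \<forall>i. frieze_row v k i > 0)"

definition const_frieze :: "nat \<Rightarrow> int \<Rightarrow> int \<Rightarrow> real" where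
  "const_frieze w i j = sin (real_of_int (j - i) * pi / real (w + 3)) / sin (pi / real (w + 3))"

definition infinitesimal_deformation :: "nat \<Rightarrow> (int \<Rightarrow> int \<Rightarrow> real) \<Rightarrow> bool" where
  "infinitesimal_deformation w d \<longleftrightarrow> frieze w (\<lambda>i j. Dual (const_frieze w i j) (d i j))"

text \<open>Number of sign changes over one period of an \<open>n\<close>-periodic sequence; vanishing terms are
  admitted, so this is the weak count.\<close>

definition sign_changes :: "nat \<Rightarrow> (int \<Rightarrow> real) \<Rightarrow> nat" where
  "sign_changes n d = card {i \<in> {0..<int n}. d i * d (i + 1) \<le> 0}"

end

theory Submission
  imports Defs
begin

text \<open>
  Write \<open>n = w + 3\<close>. A frieze pattern is governed by its first row: with
  \<open>a\<^sub>j = v\<^bsub>j-1,j+1\<^esub>\<close> every sequence \<open>j \<mapsto> v\<^bsub>i,j\<^esub>\<close> solves the discrete Hill equation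
  \<open>x\<^bsub>j+1\<^esub> + x\<^bsub>j-1\<^esub> = a\<^sub>j x\<^sub>j\<close> (\<open>recurrence\<close>), the \<open>a\<^sub>j\<close> are \<open>n\<close>-periodic, and the solutions extend
  to all integers as \<open>n\<close>-antiperiodic sequences (\<open>ext_recurrence\<close>). For positive patterns the solution
  based at \<open>i\<close> changes sign only at \<open>i\<close> modulo \<open>n\<close>.

  First row. If \<open>x\<close> and \<open>y\<close> are solutions for two patterns with coefficients \<open>a\<close> and \<open>b\<close>, then
  \<open>(a\<^sub>j - b\<^sub>j) x\<^sub>j y\<^sub>j\<close> is a difference of consecutive Wronskians, so it sums to zero over a period
  (\<open>wronskian_sum\<close>). A sequence with fewer than four sign changes has at most two genuine ones, at
  \<open>p\<close> and \<open>q\<close> say; choosing \<open>x\<close> and \<open>y\<close> to change sign at \<open>p\<close> and at \<open>q\<close> makes all terms of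
  that sum have one sign, a contradiction.

  Second row. Its entries are \<open>a\<^sub>i a\<^bsub>i-1\<^esub> - 1\<close>. The twisted Wronskian
  \<open>Z\<^sub>i = b\<^bsub>i-1\<^esub> x\<^sub>i y\<^bsub>i-1\<^esub> - a\<^bsub>i-1\<^esub> x\<^bsub>i-1\<^esub> y\<^sub>i\<close> satisfies, with
  \<open>D\<^sub>i = a\<^sub>i a\<^bsub>i-1\<^esub> - b\<^sub>i b\<^bsub>i-1\<^esub>\<close>,
  \<open>b\<^bsub>i-1\<^esub> Z\<^bsub>i+1\<^esub> = a\<^sub>i Z\<^sub>i + D\<^sub>i x\<^bsub>i-1\<^esub> y\<^sub>i\<close> and
  \<open>a\<^bsub>i-1\<^esub> Z\<^bsub>i+1\<^esub> = b\<^sub>i Z\<^sub>i + D\<^sub>i x\<^sub>i y\<^bsub>i-1\<^esub>\<close>.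
  Going once around the period with all \<open>D\<close>-terms of one sign, the first identity bounds
  \<open>(\<Prod>b - \<Prod>a) Z\<^sub>0\<close> from one side and the second bounds it from the other; hence it is zero, equality
  holds in every step, and all \<open>D\<close>-terms vanish (\<open>adjacent_product_difference_vanishes\<close>). Solutions
  \<open>x\<close> and \<open>y\<close> vanishing at \<open>p\<close> and at \<open>q\<close> again give the terms one sign.

  Infinitesimal version. The recurrence and the Wronskian identity hold over any commutative ring in
  which the inner entries are units, in particular over the dual numbers. Comparing the deformed pattern
  with the constant one, the \<open>\<epsilon>\<close>-part of the identity says that the variation \<open>c\<close> of the
  first row is orthogonal to all products \<open>sin ((j - \<alpha>) \<pi> / n) sin ((j - \<beta>) \<pi> / n)\<close>. The linearized
  recurrence builds the other rows from translates of \<open>c\<close>, and this orthogonality survives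
  translation, so each row satisfies it and the first-row argument applies.
\<close>

section \<open>Sequences with few weak sign changes\<close>

text \<open>The sign pattern, on one period, of an antiperiodic sequence that jumps from negative to
  positive between \<open>p\<close> and \<open>p + 1\<close>.\<close>

definition side :: "int \<Rightarrow> int \<Rightarrow> real" where
  "side p i = (if i \<le> p then -1 else 1)"

lemma side_weights:
  "\<sigma> * c * x * y = (\<sigma> * c * (side p i * side q i)) * ((side p i * x) * (side q i * y))"
  by (cases "i \<le> p"; cases "i \<le> q") (simp_all add: side_def)

lemma sign_changes_eq_card_nat:
  "sign_changes N c = card {i. i < N \<and> c (int i) * c (int i + 1) \<le> 0}"
proof -
  have "{i \<in> {0..<int N}. c i * c (i + 1) \<le> 0} = int ` {i. i < N \<and> c (int i) * c (int i + 1) \<le> 0}"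
    by (auto simp: image_iff) (metis nat_0_le nat_less_iff)
  then show ?thesis
    by (simp add: sign_changes_def card_image)
qed

lemma few_sign_changes_nonzero:
  assumes "N \<ge> 4" and "sign_changes N c < 4"
  obtains i where "i < N" and "c (int i) \<noteq> 0"
proof (rule ccontr)
  assume "\<not> thesis"
  then have "\<forall>i<N. c (int i) = 0" using that by blast
  then have "{i. i < N \<and> c (int i) * c (int i + 1) \<le> 0} = {..<N}" by auto
  with assms show False by (simp add: sign_changes_eq_card_nat)
qed

text \<open>Reading zeros as positive yields a periodic sequence of signs \<open>\<plusminus>1\<close>. Each of its changes is a weak
  sign change of \<open>c\<close>, so there are at most three; the product of all consecutive pairs is \<open>1\<close>, so their
  number is even. Hence there are two changes, at \<open>p < q\<close>, or none, and then \<open>p = q\<close>.\<close>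

lemma few_sign_changes_pattern:
  fixes c :: "int \<Rightarrow> real"
  assumes period: "c (int N) = c 0" and few: "sign_changes N c < 4" and "N > 0"
  obtains p q \<sigma> where "0 \<le> p" "p \<le> q" "q < int N" "\<sigma> = 1 \<or> \<sigma> = -1"
    "\<And>i. i < N \<Longrightarrow> \<sigma> * c (int i) * (side p (int i) * side q (int i)) \<ge> 0"
proof -
  define s :: "int \<Rightarrow> real" where "s i = (if c i < 0 then -1 else 1)" for i
  define F where "F = {i. i < N \<and> s (int i) \<noteq> s (int i + 1)}"
  have s: "s i = 1 \<or> s i = -1" "s i * s i = 1" for i by (auto simp: s_def)
  have "F \<subseteq> {i. i < N \<and> c (int i) * c (int i + 1) \<le> 0}"
    by (auto simp: F_def s_def mult_le_0_iff split: if_splits)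
  from card_mono[OF _ this] few have card_F: "card F \<le> 3"
    by (simp add: sign_changes_eq_card_nat)
  have telescope: "(\<Prod>i<m. s (int i) * s (int i + 1)) = s 0 * s (int m)" for m
  proof (induction m)
    case (Suc m)
    have "s 0 * s (int m) * (s (int m) * s (int m + 1)) = s 0 * (s (int m) * s (int m)) * s (int m + 1)"
      by (simp only: ac_simps)
    with Suc show ?case by (simp only: prod.lessThan_Suc s(2)) (simp add: add.commute)
  qed (simp add: s)
  have "(\<Prod>i<N. s (int i) * s (int i + 1)) = (\<Prod>i<N. if i \<in> F then -1 else 1)"
  proof (rule prod.cong)
    fix i assume "i \<in> {..<N}"
    then show "s (int i) * s (int i + 1) = (if i \<in> F then -1 else 1)"
      using s(1)[of "int i"] s(1)[of "int i + 1"] by (auto simp: F_def)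
  qed simp
  also have "\<dots> = (-1) ^ card F"
    by (simp add: prod.If_cases F_def Int_def conj_commute)
  finally have "(-1 :: real) ^ card F = s 0 * s (int N)" by (simp add: telescope)
  also have "\<dots> = 1" using period s(2) by (simp add: s_def)
  finally have "even (card F)" by (cases "even (card F)") auto
  with card_F have "card F = 0 \<or> card F = 2" by (cases "card F" rule: nat.exhaust) presburger+
  then obtain p q where pq: "p \<le> q" "q < N" and change:
    "\<And>i. i < N \<Longrightarrow> i \<in> F \<longleftrightarrow> p \<noteq> q \<and> (i = p \<or> i = q)"
  proof (elim disjE)
    assume "card F = 0"
    then have "F = {}" by (simp add: F_def)
    then show ?thesis using that[of 0 0] \<open>N > 0\<close> by auto
  next
    assume "card F = 2"
    then obtain p q where "F = {p, q}" "p \<noteq> q" by (auto simp: card_2_iff)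
    moreover from this have "p < N" "q < N" by (auto simp: F_def)
    ultimately show ?thesis
      using that[of "min p q" "max p q"] by (cases p q rule: linorder_cases) auto
  qed
  define \<sigma> where "\<sigma> = s 0 * (side (int p) 0 * side (int q) 0)"
  have const: "s (int i) * (side (int p) (int i) * side (int q) (int i)) = \<sigma>" if "i \<le> N" for i
    using that
  proof (induction i)
    case (Suc i)
    have "s (int i + 1) = (if i \<in> F then - s (int i) else s (int i))"
      using Suc.prems s(1)[of "int i"] s(1)[of "int i + 1"] by (auto simp: F_def)
    with change[of i] Suc show ?case
      by (cases "p = q") (auto simp: side_def add.commute split: if_splits)
  qed (simp add: \<sigma>_def)
  show ?thesis
  proof (rule that[of "int p" "int q" \<sigma>])
    fix i assume "i < N"
    then have "\<sigma> = s (int i) * (side (int p) (int i) * side (int q) (int i))"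
      using const[of i] by simp
    then have "\<sigma> * c (int i) * (side (int p) (int i) * side (int q) (int i)) = s (int i) * c (int i)"
      by (auto simp: side_def)
    moreover have "s (int i) * c (int i) \<ge> 0"
      by (simp add: s_def)
    ultimately show "\<sigma> * c (int i) * (side (int p) (int i) * side (int q) (int i)) \<ge> 0"
      by (simp only:)
  qed (use pq s(1)[of 0] in \<open>auto simp: \<sigma>_def side_def\<close>)
qed

text \<open>The discrete Sturm-Hurwitz argument: a sequence with two sign changes cannot be orthogonal to a
  product that changes sign in exactly the same two places.\<close>

lemma four_sign_changes_if_orthogonal:
  fixes c :: "int \<Rightarrow> real"
  assumes "N \<ge> 4" and period: "c (int N) = c 0"
    and orth: "\<And>p q. 0 \<le> p \<Longrightarrow> p < int N \<Longrightarrow> 0 \<le> q \<Longrightarrow> q < int N \<Longrightarrow>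
      \<exists>x y. (\<forall>i<N. side p (int i) * x i > 0) \<and> (\<forall>i<N. side q (int i) * y i > 0) \<and>
        (\<Sum>i<N. c (int i) * x i * y i) = 0"
  shows "sign_changes N c \<ge> 4"
proof (rule ccontr)
  assume "\<not> sign_changes N c \<ge> 4"
  then have few: "sign_changes N c < 4" by simp
  obtain p q \<sigma> where pq: "0 \<le> p" "p \<le> q" "q < int N" and \<sigma>: "\<sigma> = 1 \<or> \<sigma> = -1"
    and pattern: "\<And>i. i < N \<Longrightarrow> \<sigma> * c (int i) * (side p (int i) * side q (int i)) \<ge> 0"
    using few_sign_changes_pattern[of c N] period few \<open>N \<ge> 4\<close> by auto
  obtain x y where x: "\<And>i. i < N \<Longrightarrow> side p (int i) * x i > 0"
    and y: "\<And>i. i < N \<Longrightarrow> side q (int i) * y i > 0"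
    and sum: "(\<Sum>i<N. c (int i) * x i * y i) = 0"
    using orth[of p q] pq by auto
  have nonneg: "\<sigma> * (c (int i) * x i * y i) \<ge> 0" if "i < N" for i
  proof -
    have "\<sigma> * c (int i) * x i * y i \<ge> 0"
      using mult_nonneg_nonneg[OF pattern[OF that], of "(side p (int i) * x i) * (side q (int i) * y i)"]
        x[OF that] y[OF that]
      by (simp add: side_weights[of \<sigma> "c (int i)" "x i" "y i" p "int i" q, symmetric])
    then show ?thesis by (simp add: mult.assoc)
  qed
  have "(\<Sum>i<N. \<sigma> * (c (int i) * x i * y i)) = 0"
    using sum by (simp add: sum_distrib_left[symmetric])
  then have "\<sigma> * (c (int i) * x i * y i) = 0" if "i < N" for i
    using nonneg that by (subst (asm) sum_nonneg_eq_0_iff) auto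
  moreover obtain i where i: "i < N" "c (int i) \<noteq> 0"
    using few_sign_changes_nonzero[OF \<open>N \<ge> 4\<close> few] .
  ultimately have "\<sigma> * (c (int i) * x i * y i) = 0" by blast
  then have "x i = 0 \<or> y i = 0" using i \<sigma> by auto
  then show False using x[OF i(1)] y[OF i(1)] by auto
qed

section \<open>The Hill equation of a frieze pattern\<close>

lemma periodic_int_cases:
  fixes n i j :: int
  assumes "n > 0" and step: "\<And>j. P (j + n) \<longleftrightarrow> P j"
    and base: "\<And>j. i \<le> j \<Longrightarrow> j < i + n \<Longrightarrow> P j"
  shows "P j"
proof -
  have multiple: "P (r + n * q) \<longleftrightarrow> P r" for r q
  proof (induction q rule: int_induct[where k = 0])
    case (step1 q)
    then show ?case using step[of "r + n * q"] by (simp add: algebra_simps)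
  next
    case (step2 q)
    then show ?case using step[of "r + n * (q - 1)"] by (simp add: algebra_simps)
  qed simp
  have "P (i + (j - i) mod n)"
    using assms(1) by (intro base) auto
  with multiple[of "i + (j - i) mod n" "(j - i) div n"] show ?thesis
    by (simp add: algebra_simps)
qed

text \<open>Requiring units rather than nonzero entries covers both positive real patterns and deformations of
  the constant one over the dual numbers.\<close>

locale unit_frieze =
  fixes w :: nat and v :: "int \<Rightarrow> int \<Rightarrow> 'a::comm_ring_1"
  assumes frieze: "frieze w v"
    and unit: "\<And>i j. i < j \<Longrightarrow> j < i + int (w + 3) \<Longrightarrow> v i j dvd 1"
begin

lemma border:
  "v i i = 0" "v i (i + 1) = 1" "v i (i + int (w + 3) - 1) = 1" "v i (i + int (w + 3)) = 0"
  using frieze by (auto simp: frieze_def Let_def)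

lemma unimodular:
  assumes "i + 2 \<le> j" "j \<le> i + int (w + 3)"
  shows "v i (j - 1) * v (i + 1) j - v i j * v (i + 1) (j - 1) = 1"
  using frieze assms by (simp add: frieze_def Let_def)

definition quiddity :: "int \<Rightarrow> 'a" where "quiddity j = v (j - 1) (j + 1)"

text \<open>The difference of two neighbouring unimodular relations shows that the ratio of
  \<open>v\<^bsub>i,j+1\<^esub> + v\<^bsub>i,j-1\<^esub>\<close> to \<open>v\<^bsub>i,j\<^esub>\<close> does not change when \<open>i\<close> is lowered by one. At \<open>i = j - 1\<close> this
  ratio is the first-row entry.\<close>

lemma recurrence:
  assumes "i < j" "j < i + int (w + 3)"
  shows "v i (j + 1) + v i (j - 1) = quiddity j * v i j"
proof -
  have "j < i + int (w + 3) \<Longrightarrow> v i (j + 1) + v i (j - 1) = quiddity j * v i j" 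
    if "i \<le> j - 1" for i
    using that
  proof (induction i rule: int_le_induct)
    case base
    show ?case using border[of "j - 1"] by (simp add: quiddity_def)
  next
    case (step i)
    obtain e where e: "1 = v i j * e"
      using step unit[of i j] by (auto simp: dvd_def)
    have IH: "v i (j + 1) + v i (j - 1) = quiddity j * v i j" using step by simp
    have "v (i - 1) (j - 1) * v i j - v (i - 1) j * v i (j - 1) =
        v (i - 1) j * v i (j + 1) - v (i - 1) (j + 1) * v i j"
      using unimodular[of "i - 1" j] unimodular[of "i - 1" "j + 1"] step by simp
    then have "v i j * (v (i - 1) (j + 1) + v (i - 1) (j - 1)) =
        v (i - 1) j * (v i (j + 1) + v i (j - 1))"
      by (simp add: algebra_simps)
    also have "\<dots> = v i j * (quiddity j * v (i - 1) j)"
      unfolding IH by (simp only: ac_simps)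
    finally have "e * (v i j * (v (i - 1) (j + 1) + v (i - 1) (j - 1))) =
        e * (v i j * (quiddity j * v (i - 1) j))"
      by simp
    moreover have "e * (v i j * x) = x" for x
      using e by (simp add: mult.assoc[symmetric] mult.commute[of e])
    ultimately show ?case by simp
  qed
  with assms show ?thesis by simp
qed

end

text \<open>The reflection exchanges the two indices, so it turns the recurrence in \<open>j\<close> into one in \<open>i\<close>.\<close>

lemma unit_frieze_reflect:
  assumes "unit_frieze w v"
  shows "unit_frieze w (\<lambda>i j. v (- j) (- i))"
proof -
  interpret unit_frieze w v by fact
  show ?thesis
  proof
    show "frieze w (\<lambda>i j. v (- j) (- i))"
      unfolding frieze_def Let_def
    proof (intro conjI allI impI)
      fix i j :: int
      show "v (- i) (- i) = 0" "v (- (i + 1)) (- i) = 1"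
        "v (- (i + (int w + 3) - 1)) (- i) = 1" "v (- (i + (int w + 3))) (- i) = 0"
        using border(1,2,3,4)[of "- i"] border(2)[of "- (i + 1)"]
          border(3)[of "- (i + (int w + 3) - 1)"] border(4)[of "- (i + (int w + 3))"]
        by (simp_all add: algebra_simps)
      assume "i + 2 \<le> j \<and> j \<le> i + (int w + 3)"
      then show "v (- (j - 1)) (- i) * v (- j) (- (i + 1)) - v (- j) (- i) * v (- (j - 1)) (- (i + 1)) = 1"
        using unimodular[of "- j" "- i"] by (simp add: minus_diff_commute mult.commute)
    qed
  qed (use unit in auto)
qed

lemma unit_frieze_shift:
  assumes "unit_frieze w v"
  shows "unit_frieze w (\<lambda>i j. v (i + m) (j + m))"
proof -
  interpret unit_frieze w v by fact
  show ?thesis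
  proof
    show "frieze w (\<lambda>i j. v (i + m) (j + m))"
      unfolding frieze_def Let_def
    proof (intro conjI allI impI)
      fix i j :: int
      show "v (i + m) (i + m) = 0" "v (i + m) (i + 1 + m) = 1"
        "v (i + m) (i + (int w + 3) - 1 + m) = 1" "v (i + m) (i + (int w + 3) + m) = 0"
        using border[of "i + m"] by (simp_all add: algebra_simps)
      assume "i + 2 \<le> j \<and> j \<le> i + (int w + 3)"
      then show "v (i + m) (j - 1 + m) * v (i + 1 + m) (j + m) - v (i + m) (j + m) * v (i + 1 + m) (j - 1 + m) = 1"
        using unimodular[of "i + m" "j + m"] by (simp add: algebra_simps)
    qed
  qed (use unit in auto)
qed

context unit_frieze
begin

text \<open>The last nontrivial entry \<open>v\<^bsub>j+1,j+n-1\<^esub>\<close> is determined in two ways by the bottom border: the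
  recurrence in the second index makes it the first-row entry at \<open>j + n\<close>, the reflected recurrence in
  the first index makes it the one at \<open>j\<close>.\<close>

lemma quiddity_periodic: "quiddity (j + int (w + 3)) = quiddity j"
proof -
  let ?v = "\<lambda>i j. v (- j) (- i)"
  interpret r: unit_frieze w ?v
    by (rule unit_frieze_reflect) (rule unit_frieze_axioms)
  have "v (j + 1) (j + int w + 2) = quiddity (j + int (w + 3))"
    using recurrence[of "j + 1" "j + int (w + 3)"] border(3,4)[of "j + 1"]
    by (simp add: algebra_simps)
  moreover have "v (j + 1) (j + int w + 2) = quiddity j"
    using r.recurrence[of "- j - int w - 2" "- j"] r.border(3,4)[of "- j - int w - 2"]
    by (simp add: algebra_simps r.quiddity_def quiddity_def)
  ultimately show ?thesis by simp
qed

lemma second_row_eq: "v (i - 2) (i + 1) = quiddity i * quiddity (i - 1) - 1"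
  using recurrence[of "i - 2" i] border(2)[of "i - 2"] by (simp add: quiddity_def algebra_simps)

text \<open>The antiperiodic continuation, in the second index, of the strip \<open>i \<le> j \<le> i + n\<close>.\<close>

definition ext :: "int \<Rightarrow> int \<Rightarrow> 'a" where
  "ext i j = (let q = (j - i) div int (w + 3); r = (j - i) mod int (w + 3)
    in if even q then v i (i + r) else - v i (i + r))"

lemma ext_antiperiodic: "ext i (j + int (w + 3)) = - ext i j"
proof -
  have "(j + int (w + 3) - i) = (j - i) + int (w + 3)" by simp
  then show ?thesis unfolding ext_def Let_def
    by (simp only: div_add_self2 mod_add_self2) auto
qed

lemma ext_eq:
  assumes "i \<le> j" "j \<le> i + int (w + 3)"
  shows "ext i j = v i j"
proof (cases "j = i + int (w + 3)")
  case True
  have "ext i i = 0" by (simp add: ext_def border)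
  then show ?thesis using True ext_antiperiodic[of i i] border(4)[of i] by simp
next
  case False
  then have "(j - i) div int (w + 3) = 0" "(j - i) mod int (w + 3) = j - i"
    using assms by (simp_all add: div_pos_pos_trivial mod_pos_pos_trivial)
  then show ?thesis by (simp add: ext_def)
qed

lemma ext_eq_left:
  assumes "i - int (w + 3) \<le> j" "j \<le> i"
  shows "ext i j = - v i (j + int (w + 3))"
  using ext_antiperiodic[of i j] ext_eq[of i "j + int (w + 3)"] assms
  by (metis add_le_cancel_right diff_add_cancel minus_minus)

lemma ext_recurrence: "ext i (j + 1) + ext i (j - 1) = quiddity j * ext i j"
proof (rule periodic_int_cases[where n = "int (w + 3)" and i = i and j = j])
  fix j
  have "ext i (j + int (w + 3) + 1) = - ext i (j + 1)"
    "ext i (j + int (w + 3) - 1) = - ext i (j - 1)"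
    using ext_antiperiodic[of i "j + 1"] ext_antiperiodic[of i "j - 1"]
    by (simp_all add: algebra_simps)
  then show "ext i (j + int (w + 3) + 1) + ext i (j + int (w + 3) - 1) =
      quiddity (j + int (w + 3)) * ext i (j + int (w + 3)) \<longleftrightarrow>
    ext i (j + 1) + ext i (j - 1) = quiddity j * ext i j"
    unfolding ext_antiperiodic quiddity_periodic
    by (simp only: minus_add_distrib[symmetric] mult_minus_right neg_equal_iff_equal)
next
  fix j assume j: "i \<le> j" "j < i + int (w + 3)"
  show "ext i (j + 1) + ext i (j - 1) = quiddity j * ext i j"
  proof (cases "j = i")
    case True
    then show ?thesis
      using ext_eq[of i i] ext_eq[of i "i + 1"] ext_eq_left[of i "i - 1"] border[of i]
      by (simp add: algebra_simps)
  next
    case False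
    then show ?thesis using j recurrence[of i j] by (simp add: ext_eq)
  qed
qed simp

end

section \<open>Sign patterns of solutions for positive patterns\<close>

lemma positive_frieze_entry:
  assumes "positive_frieze w v" "i < j" "j < i + int (w + 3)"
  shows "v i j > 0"
proof -
  have border: "v i (i + 1) = 1" "v i (i + int w + 2) = 1"
    using assms(1) by (auto simp: positive_frieze_def frieze_def Let_def algebra_simps)
  consider "j = i + 1" | "j = i + int w + 2" | "i + 2 \<le> j" "j \<le> i + int w + 1"
    using assms by force
  then show ?thesis
  proof cases
    case 3
    then have "nat (j - i - 1) \<in> {1..w}" by auto
    then have "frieze_row v (nat (j - i - 1)) i > 0"
      using assms(1) by (auto simp: positive_frieze_def)
    then show ?thesis using 3 by (simp add: frieze_row_def)
  qed (use border in auto)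
qed

lemma positive_frieze_unit: "positive_frieze w v \<Longrightarrow> unit_frieze w v"
  using positive_frieze_entry[of w v]
  by unfold_locales (fastforce simp: positive_frieze_def dvd_field_iff)+

lemma positive_frieze_shift:
  assumes "positive_frieze w v"
  shows "positive_frieze w (\<lambda>i j. v (i + m) (j + m))"
proof -
  have "frieze_row (\<lambda>i j. v (i + m) (j + m)) k i = frieze_row v k (i + m)" for k i
    by (simp add: frieze_row_def algebra_simps)
  then show ?thesis
    using assms unit_frieze.frieze[OF unit_frieze_shift[OF positive_frieze_unit[OF assms], of m]]
    by (simp add: positive_frieze_def)
qed

locale positive_frieze_array =
  fixes w :: nat and v :: "int \<Rightarrow> int \<Rightarrow> real"
  assumes positive: "positive_frieze w v"

sublocale positive_frieze_array \<subseteq> unit_frieze w v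
  by (rule positive_frieze_unit) (rule positive)

context positive_frieze_array
begin

lemma quiddity_positive: "quiddity j > 0"
  using positive_frieze_entry[OF positive, of "j - 1" "j + 1"] by (simp add: quiddity_def)

lemma ext_pos: "p < i \<Longrightarrow> i < p + int (w + 3) \<Longrightarrow> ext p i > 0"
  using positive_frieze_entry[OF positive, of p i] by (simp add: ext_eq)

lemma ext_neg: "p - int (w + 3) < i \<Longrightarrow> i < p \<Longrightarrow> ext p i < 0"
  using positive_frieze_entry[OF positive, of p "i + int (w + 3)"] by (simp add: ext_eq_left)

lemma ext_zero: "ext p p = 0" "ext p (p + int (w + 3)) = 0" "ext p (p - int (w + 3)) = 0"
  using border(1,4)[of p] by (simp_all add: ext_eq ext_eq_left)

lemma ext_eq_0_iff:
  assumes "p - int (w + 3) \<le> i" "i \<le> p + int (w + 3)"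
  shows "ext p i = 0 \<longleftrightarrow> i = p \<or> i = p + int (w + 3) \<or> i = p - int (w + 3)"
proof -
  consider "i = p" | "i = p + int (w + 3)" | "i = p - int (w + 3)" | 
    "p < i" "i < p + int (w + 3)" | "p - int (w + 3) < i" "i < p"
    using assms by linarith
  then show ?thesis
    by cases (use ext_zero[of p] ext_pos[of p i] ext_neg[of p i] in auto)
qed

text \<open>The second claim concerns the argument delayed by one step: since \<open>ext p\<close> vanishes at \<open>p\<close>, it may be
  assigned either sign there, so both \<open>ext p i\<close> and \<open>ext p (i - 1)\<close> follow the pattern \<open>side p i\<close>.\<close>

lemma side_ext_nonneg:
  assumes "p - int (w + 3) \<le> i" "i \<le> p + int (w + 3)"
  shows "side p i * ext p i \<ge> 0" 
    and "i \<noteq> p + int (w + 3) \<Longrightarrow> side p (i + 1) * ext p i \<ge> 0"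
proof -
  consider "i = p" | "i = p + int (w + 3)" | "i = p - int (w + 3)" | 
    "p < i" "i < p + int (w + 3)" | "p - int (w + 3) < i" "i < p"
    using assms by linarith
  then have "side p i * ext p i \<ge> 0 \<and> (i \<noteq> p + int (w + 3) \<longrightarrow> side p (i + 1) * ext p i \<ge> 0)"
    by cases (use ext_zero[of p] ext_pos[of p i] ext_neg[of p i] in \<open>auto simp: side_def\<close>)
  then show "side p i * ext p i \<ge> 0" 
    and "i \<noteq> p + int (w + 3) \<Longrightarrow> side p (i + 1) * ext p i \<ge> 0" by auto
qed

text \<open>Adding two neighbouring solutions moves the zero strictly between \<open>p\<close> and \<open>p + 1\<close>.\<close>

lemma side_ext_pos:
  assumes "p - int (w + 3) < i" "i \<le> p + int (w + 3)"
  shows "side p i * (ext p i + ext (p + 1) i) > 0"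
proof (cases "i \<le> p")
  case True
  then have "ext p i \<le> 0" "ext (p + 1) i \<le> 0" "i \<noteq> p \<Longrightarrow> ext p i < 0" 
    "i = p \<Longrightarrow> ext (p + 1) i < 0"
    using assms ext_zero[of p] ext_zero(3)[of "p + 1"] ext_neg[of p i] ext_neg[of "p + 1" i]
    by (cases "i = p"; cases "i = p + 1 - int (w + 3)"; force)+
  then show ?thesis using True by (cases "i = p") (auto simp: side_def)
next
  case False
  then have "ext p i \<ge> 0" "ext (p + 1) i \<ge> 0" "i \<noteq> p + 1 \<Longrightarrow> ext (p + 1) i > 0" 
    "i = p + 1 \<Longrightarrow> ext p i > 0"
    using assms ext_zero[of p] ext_zero(1)[of "p + 1"] ext_pos[of p i] ext_pos[of "p + 1" i]
    by (cases "i = p + 1"; cases "i = p + int (w + 3)"; force)+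
  then show ?thesis using False by (cases "i = p + 1") (auto simp: side_def)
qed

end

section \<open>First rows: the Wronskian identity\<close>

text \<open>Each summand is the increment of the Wronskian \<open>x\<^sub>j y\<^bsub>j-1\<^esub> - x\<^bsub>j-1\<^esub> y\<^sub>j\<close>, which is periodic because
  both factors change sign over a period.\<close>

lemma wronskian_sum:
  fixes x y a b :: "int \<Rightarrow> 'a::comm_ring_1"
  assumes x: "\<And>j. x (j + 1) + x (j - 1) = a j * x j" "\<And>j. x (j + int N) = - x j"
    and y: "\<And>j. y (j + 1) + y (j - 1) = b j * y j" "\<And>j. y (j + int N) = - y j"
  shows "(\<Sum>j<N. (a (int j) - b (int j)) * x (int j) * y (int j)) = 0"
proof -
  define W where "W j = x j * y (j - 1) - x (j - 1) * y j" for j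
  have step: "(a j - b j) * x j * y j = W (j + 1) - W j" for j
  proof -
    have "(a j - b j) * x j * y j = (a j * x j) * y j - x j * (b j * y j)"
      by (simp add: algebra_simps)
    also have "\<dots> = W (j + 1) - W j"
      by (simp only: x(1)[symmetric] y(1)[symmetric] W_def) (simp add: algebra_simps)
    finally show ?thesis .
  qed
  have "(\<Sum>j<m. W (int j + 1) - W (int j)) = W (int m) - W 0" for m
    by (induction m) (simp_all add: add.commute)
  moreover have "W (int N) = W 0"
    using x(2)[of 0] x(2)[of "-1"] y(2)[of 0] y(2)[of "-1"] by (simp add: W_def)
  ultimately show ?thesis by (simp add: step)
qed

lemma first_row_difference:
  assumes "positive_frieze w v" "positive_frieze w u" "w \<ge> 1"
  shows "sign_changes (w + 3) (\<lambda>i. v (i - 1) (i + 1) - u (i - 1) (i + 1)) \<ge> 4"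
proof -
  interpret V: positive_frieze_array w v by unfold_locales fact
  interpret U: positive_frieze_array w u by unfold_locales fact
  show ?thesis
  proof (rule four_sign_changes_if_orthogonal)
    fix p q :: int
    assume pq: "0 \<le> p" "p < int (w + 3)" "0 \<le> q" "q < int (w + 3)"
    let ?x = "\<lambda>i. V.ext p i + V.ext (p + 1) i" and ?y = "\<lambda>i. U.ext q i + U.ext (q + 1) i"
    have "(\<Sum>j<w + 3. (V.quiddity (int j) - U.quiddity (int j)) * ?x (int j) * ?y (int j)) = 0"
    proof (rule wronskian_sum)
      fix j
      show "?x (j + 1) + ?x (j - 1) = V.quiddity j * ?x j"
        using V.ext_recurrence[of p j] V.ext_recurrence[of "p + 1" j] by (simp add: algebra_simps)
      show "?y (j + 1) + ?y (j - 1) = U.quiddity j * ?y j"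
        using U.ext_recurrence[of q j] U.ext_recurrence[of "q + 1" j] by (simp add: algebra_simps)
    qed (simp_all only: V.ext_antiperiodic U.ext_antiperiodic minus_add_distrib)
    moreover have "side p (int i) * ?x (int i) > 0" "side q (int i) * ?y (int i) > 0" if "i < w + 3" for i
      using V.side_ext_pos[of p "int i"] U.side_ext_pos[of q "int i"] pq that by auto
    ultimately show "\<exists>x y. (\<forall>i<w + 3. side p (int i) * x i > 0) \<and>
        (\<forall>i<w + 3. side q (int i) * y i > 0) \<and>
        (\<Sum>i<w + 3. (v (int i - 1) (int i + 1) - u (int i - 1) (int i + 1)) * x i * y i) = 0"
      by (intro exI[of _ "\<lambda>i. ?x (int i)"] exI[of _ "\<lambda>i. ?y (int i)"])
        (simp add: V.quiddity_def U.quiddity_def)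
  next
    show "v (int (w + 3) - 1) (int (w + 3) + 1) - u (int (w + 3) - 1) (int (w + 3) + 1) =
        v (0 - 1) (0 + 1) - u (0 - 1) (0 + 1)"
      using V.quiddity_periodic[of 0] U.quiddity_periodic[of 0] by (simp add: V.quiddity_def U.quiddity_def add.commute)
  qed (use assms in simp)
qed

section \<open>Second rows: a twisted Wronskian\<close>

lemma product_growth:
  fixes z \<alpha> \<beta> :: "nat \<Rightarrow> real"
  assumes "\<And>i. i < n \<Longrightarrow> \<alpha> i > 0 \<and> \<beta> i > 0" "\<And>i. i < n \<Longrightarrow> \<beta> i * z (Suc i) \<ge> \<alpha> i * z i"
  shows "(\<Prod>i<n. \<beta> i) * z n \<ge> (\<Prod>i<n. \<alpha> i) * z 0"
  using assms
proof (induction n)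
  case (Suc n)
  have "(\<Prod>i<Suc n. \<alpha> i) * z 0 = \<alpha> n * ((\<Prod>i<n. \<alpha> i) * z 0)" by (simp add: ac_simps)
  also have "\<dots> \<le> \<alpha> n * ((\<Prod>i<n. \<beta> i) * z n)"
    using Suc.IH Suc.prems by (intro mult_left_mono) (auto simp: less_imp_le)
  also have "\<dots> = (\<Prod>i<n. \<beta> i) * (\<alpha> n * z n)" by (simp add: ac_simps)
  also have "\<dots> \<le> (\<Prod>i<n. \<beta> i) * (\<beta> n * z (Suc n))"
    using Suc.prems by (intro mult_left_mono prod_nonneg) (auto simp: less_imp_le)
  finally show ?case by (simp add: ac_simps)
qed simp

text \<open>If the accumulated inequality of \<open>product_growth\<close> is an equality, so is each single step.\<close>

lemma product_growth_equality:
  fixes z \<alpha> \<beta> :: "nat \<Rightarrow> real"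
  assumes "\<And>i. i < n \<Longrightarrow> \<alpha> i > 0 \<and> \<beta> i > 0" "\<And>i. i < n \<Longrightarrow> \<beta> i * z (Suc i) \<ge> \<alpha> i * z i"
    and "(\<Prod>i<n. \<beta> i) * z n \<le> (\<Prod>i<n. \<alpha> i) * z 0" and "i < n"
  shows "\<beta> i * z (Suc i) = \<alpha> i * z i"
  using assms
proof (induction n arbitrary: i)
  case (Suc n)
  have pos: "(\<Prod>i<n. \<beta> i) > 0" "\<alpha> n > 0" using Suc.prems(1) by (auto intro!: prod_pos)
  have low: "(\<Prod>i<n. \<alpha> i) * z 0 \<le> (\<Prod>i<n. \<beta> i) * z n"
    using Suc.prems by (intro product_growth) auto
  have last: "(\<Prod>i<n. \<beta> i) * (\<alpha> n * z n) \<le> (\<Prod>i<n. \<beta> i) * (\<beta> n * z (Suc n))"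
    using Suc.prems(2)[of n] pos by (intro mult_left_mono) auto
  have upper: "(\<Prod>i<n. \<beta> i) * (\<beta> n * z (Suc n)) \<le> \<alpha> n * ((\<Prod>i<n. \<alpha> i) * z 0)"
    using Suc.prems(3) by (simp add: ac_simps)
  have "\<alpha> n * ((\<Prod>i<n. \<beta> i) * z n) \<le> \<alpha> n * ((\<Prod>i<n. \<alpha> i) * z 0)"
    using last upper by (simp add: ac_simps)
  then have *: "(\<Prod>i<n. \<beta> i) * z n \<le> (\<Prod>i<n. \<alpha> i) * z 0" using pos by simp
  have "\<alpha> n * ((\<Prod>i<n. \<alpha> i) * z 0) \<le> \<alpha> n * ((\<Prod>i<n. \<beta> i) * z n)"
    using low pos by (intro mult_left_mono) auto
  with upper have "(\<Prod>i<n. \<beta> i) * (\<beta> n * z (Suc n)) \<le> (\<Prod>i<n. \<beta> i) * (\<alpha> n * z n)"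
    by (simp add: ac_simps)
  then have "\<beta> n * z (Suc n) \<le> \<alpha> n * z n" using pos by simp
  with Suc.prems(2)[of n] have "\<beta> n * z (Suc n) = \<alpha> n * z n" by simp
  moreover have "\<beta> i * z (Suc i) = \<alpha> i * z i" if "i < n"
    using Suc.IH[OF _ _ * that] Suc.prems(1,2) by simp
  ultimately show ?case using \<open>i < Suc n\<close> by (cases "i = n") auto
qed simp

lemma prod_periodic_shift:
  fixes b :: "int \<Rightarrow> real"
  assumes "b (int N - 1) = b (-1)"
  shows "(\<Prod>i<N. b (int i - 1)) = (\<Prod>i<N. b (int i))"
proof (cases N)
  case (Suc m)
  have "(\<Prod>i<N. b (int i - 1)) = b (-1) * (\<Prod>i<m. b (int i))"
    unfolding Suc by (subst prod.lessThan_Suc_shift) simp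
  then show ?thesis using assms Suc by (simp add: mult.commute)
qed simp

text \<open>Neither of the two identities \<open>step1\<close> and \<open>step2\<close> telescopes, because \<open>\<Prod>a\<close> and \<open>\<Prod>b\<close> may
  differ. But \<open>a\<close> and \<open>b\<close> exchange roles between them, so that the two one-sided bounds
  \<open>le\<close> combine to \<open>\<Prod>a Z\<^sub>0 = \<Prod>b Z\<^sub>0\<close>, which forces equality in every step.\<close>

lemma adjacent_product_difference_vanishes:
  fixes x y a b :: "int \<Rightarrow> real"
  defines "D \<equiv> \<lambda>i. a i * a (i - 1) - b i * b (i - 1)"
  assumes x: "\<And>j. x (j + 1) + x (j - 1) = a j * x j" "\<And>j. x (j + int N) = - x j"
    and y: "\<And>j. y (j + 1) + y (j - 1) = b j * y j" "\<And>j. y (j + int N) = - y j"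
    and a: "\<And>j. a j > 0" "\<And>j. a (j + int N) = a j"
    and b: "\<And>j. b j > 0" "\<And>j. b (j + int N) = b j"
    and sign: "\<And>i. i < N \<Longrightarrow> \<sigma> * D (int i) * x (int i - 1) * y (int i) \<ge> 0"
      "\<And>i. i < N \<Longrightarrow> \<sigma> * D (int i) * x (int i) * y (int i - 1) \<ge> 0"
    and "i < N"
  shows "\<sigma> * D (int i) * x (int i - 1) * y (int i) = 0" 
    "\<sigma> * D (int i) * x (int i) * y (int i - 1) = 0"
proof -
  define Z where "Z j = b (j - 1) * x j * y (j - 1) - a (j - 1) * x (j - 1) * y j" for j
  define z where "z i = \<sigma> * Z (int i)" for i
  have Z_Suc: "Z (j + 1) = a j * x j * y (j - 1) - b j * x (j - 1) * y j" for j
  proof -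
    have "x (j + 1) = a j * x j - x (j - 1)" "y (j + 1) = b j * y j - y (j - 1)"
      using x(1)[of j] y(1)[of j] by linarith+
    moreover have "Z (j + 1) = b j * x (j + 1) * y j - a j * x j * y (j + 1)"
      by (simp add: Z_def)
    ultimately show ?thesis
      by (simp only:) (simp add: algebra_simps)
  qed
  have step1: "b (int i - 1) * z (Suc i) = a (int i) * z i + \<sigma> * D (int i) * x (int i - 1) * y (int i)"
    and step2: "a (int i - 1) * z (Suc i) = b (int i) * z i + \<sigma> * D (int i) * x (int i) * y (int i - 1)" for i
    using Z_Suc[of "int i"] by (simp_all add: z_def D_def add.commute) (simp_all add: Z_def algebra_simps)
  have "Z (int N) = Z 0"
    using x(2)[of 0] y(2)[of 0] x(2)[of "-1"] y(2)[of "-1"] a(2)[of "-1"] b(2)[of "-1"]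
    by (simp add: Z_def)
  then have zN: "z N = z 0" by (simp add: z_def)
  have prods: "(\<Prod>i<N. a (int i - 1)) = (\<Prod>i<N. a (int i))" "(\<Prod>i<N. b (int i - 1)) = (\<Prod>i<N. b (int i))"
    using a(2)[of "-1"] b(2)[of "-1"] by (simp_all add: prod_periodic_shift)
  have le: "(\<Prod>i<N. b (int i - 1)) * z N \<ge> (\<Prod>i<N. a (int i)) * z 0"
    "(\<Prod>i<N. a (int i - 1)) * z N \<ge> (\<Prod>i<N. b (int i)) * z 0"
    using a b sign by (intro product_growth; simp add: step1 step2)+
  have "b (int i - 1) * z (Suc i) = a (int i) * z i" 
    using a b sign le \<open>i < N\<close> by (intro product_growth_equality[where n = N]) (simp_all add: step1 prods zN)
  then show "\<sigma> * D (int i) * x (int i - 1) * y (int i) = 0" by (simp add: step1)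
  have "a (int i - 1) * z (Suc i) = b (int i) * z i" 
    using a b sign le \<open>i < N\<close> by (intro product_growth_equality[where n = N]) (simp_all add: step2 prods zN)
  then show "\<sigma> * D (int i) * x (int i) * y (int i - 1) = 0" by (simp add: step2)
qed


text \<open>The solutions vanish at \<open>p\<close> and at \<open>q\<close>, so single terms of the two identities may be zero for
  trivial reasons. At a given index both terms are trivial only if \<open>x\<close> and \<open>y\<close> have a common zero there
  or just before.\<close>

lemma second_row_difference:
  assumes "positive_frieze w v" "positive_frieze w u" "w \<ge> 1"
  shows "sign_changes (w + 3) (\<lambda>i. v (i - 2) (i + 1) - u (i - 2) (i + 1)) \<ge> 4"
proof (rule ccontr)
  interpret V: positive_frieze_array w v by unfold_locales fact
  interpret U: positive_frieze_array w u by unfold_locales fact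
  define D where "D i = V.quiddity i * V.quiddity (i - 1) - U.quiddity i * U.quiddity (i - 1)" for i
  let ?N = "w + 3"
  assume "\<not> sign_changes (w + 3) (\<lambda>i. v (i - 2) (i + 1) - u (i - 2) (i + 1)) \<ge> 4"
  then have few: "sign_changes ?N D < 4"
    by (simp add: V.second_row_eq U.second_row_eq D_def[abs_def])
  have "D (int ?N) = D 0"
    using V.quiddity_periodic[of 0] U.quiddity_periodic[of 0] V.quiddity_periodic[of "-1"] U.quiddity_periodic[of "-1"]
    by (simp add: D_def)
  then obtain p0 q0 \<sigma> where pq0: "0 \<le> p0" "p0 \<le> q0" "q0 < int ?N" and \<sigma>: "\<sigma> = 1 \<or> \<sigma> = -1"
    and pattern0: "\<And>i. i < ?N \<Longrightarrow> \<sigma> * D (int i) * (side p0 (int i) * side q0 (int i)) \<ge> 0"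
    using few_sign_changes_pattern[of D ?N] few by auto
  obtain k where k: "k < ?N" "D (int k) \<noteq> 0"
    using few_sign_changes_nonzero[OF _ few] \<open>w \<ge> 1\<close> by auto
  obtain p q where pq: "0 \<le> p" "p < int ?N" "0 \<le> q" "q < int ?N"
    and pattern: "\<And>i. i < ?N \<Longrightarrow> \<sigma> * D (int i) * (side p (int i) * side q (int i)) \<ge> 0"
    and apart: "p = q \<Longrightarrow> int k \<noteq> p \<and> int k \<noteq> p + 1 \<and> \<not> (k = 0 \<and> p = int ?N - 1)"
  proof (cases "p0 = q0")
    case True
    \<comment> \<open>\<open>D\<close> has constant sign, so the common zero is free to move: it is placed away from \<open>k\<close> and
      \<open>k - 1\<close>.\<close>
    define r where "r = (if k + 1 < ?N then int k + 1 else 0)"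
    have "side r i * side r i = side p0 i * side q0 i" for i
      using True by (simp add: side_def)
    then show ?thesis
      using pattern0 k(1) by (intro that[of r r]) (auto simp: r_def split: if_splits)
  next
    case False
    then show ?thesis using that[of p0 q0] pq0 pattern0 by auto
  qed
  let ?x = "V.ext p" and ?y = "U.ext q"
  have weight: "\<sigma> * D (int i) * s * t \<ge> 0"
    if "i < ?N" "side p (int i) * s \<ge> 0" "side q (int i) * t \<ge> 0" for i s t
    using mult_nonneg_nonneg[OF pattern[OF that(1)], of "(side p (int i) * s) * (side q (int i) * t)"] that
    by (simp add: side_weights[of \<sigma> "D (int i)" s t p "int i" q, symmetric])
  have sides: "side p (int i) * ?x (int i) \<ge> 0" "side p (int i) * ?x (int i - 1) \<ge> 0"
    "side q (int i) * ?y (int i) \<ge> 0" "side q (int i) * ?y (int i - 1) \<ge> 0" if "i < ?N" for i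
    using V.side_ext_nonneg(1)[of p "int i"] V.side_ext_nonneg(2)[of p "int i - 1"]
      U.side_ext_nonneg(1)[of q "int i"] U.side_ext_nonneg(2)[of q "int i - 1"] that pq by auto
  have "\<sigma> * D (int k) * ?x (int k - 1) * ?y (int k) = 0"
    "\<sigma> * D (int k) * ?x (int k) * ?y (int k - 1) = 0"
    unfolding D_def
    by (rule adjacent_product_difference_vanishes[where a = V.quiddity and b = U.quiddity and N = ?N and x = ?x and y = ?y];
        (rule V.ext_recurrence U.ext_recurrence V.ext_antiperiodic U.ext_antiperiodic V.quiddity_positive
          U.quiddity_positive V.quiddity_periodic U.quiddity_periodic k(1))?;
        use weight sides in \<open>simp add: D_def[symmetric]\<close>)+
  then have "?x (int k - 1) = 0 \<or> ?y (int k) = 0" "?x (int k) = 0 \<or> ?y (int k - 1) = 0"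
    using k \<sigma> by auto
  then show False
    using pq apart k(1) \<open>w \<ge> 1\<close> V.ext_eq_0_iff[of p "int k"] V.ext_eq_0_iff[of p "int k - 1"]
      U.ext_eq_0_iff[of q "int k"] U.ext_eq_0_iff[of q "int k - 1"] by auto
qed

section \<open>Infinitesimal deformations of the constant pattern\<close>

text \<open>Equivalently, the harmonics of order \<open>0\<close> and \<open>\<plusminus>1\<close> of \<open>f\<close> vanish. With products of sines the
  property is visibly invariant under translation of an \<open>N\<close>-periodic \<open>f\<close> and directly usable for sign counting.\<close>

definition orthogonal_to_sines :: "nat \<Rightarrow> (int \<Rightarrow> real) \<Rightarrow> bool" where
  "orthogonal_to_sines N f \<longleftrightarrow> (\<forall>\<alpha> \<beta>.
    (\<Sum>i<N. f (int i) * sin ((real i - \<alpha>) * (pi / N)) * sin ((real i - \<beta>) * (pi / N))) = 0)"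

lemma orthogonal_to_sines_shift:
  assumes "orthogonal_to_sines N f" "\<And>i. f (i + int N) = f i" "N > 0"
  shows "orthogonal_to_sines N (\<lambda>i. f (i + int m))"
  unfolding orthogonal_to_sines_def
proof (intro allI)
  fix \<alpha> \<beta> :: real
  define F where "F i = f i * sin ((real_of_int i - (\<alpha> + m)) * (pi / N)) *
    sin ((real_of_int i - (\<beta> + m)) * (pi / N))" for i
  have anti: "sin ((real_of_int (i + int N) - \<gamma>) * (pi / N)) = - sin ((real_of_int i - \<gamma>) * (pi / N))" for i \<gamma>
  proof -
    have "(real_of_int (i + int N) - \<gamma>) * (pi / N) = (real_of_int i - \<gamma>) * (pi / N) + pi"
      using \<open>N > 0\<close> by (simp add: field_simps)
    then show ?thesis by (simp only: sin_periodic_pi)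
  qed
  have F_periodic: "F (i + int N) = F i" for i
    unfolding F_def anti assms(2) by simp
  have step: "(\<Sum>i<n. F (int i + int (Suc j))) = (\<Sum>i<n. F (int i + int j)) + F (int n + int j) - F (int j)" for n j
    by (induction n) (simp_all add: algebra_simps)
  have "(\<Sum>i<N. F (int i + int j)) = (\<Sum>i<N. F (int i))" for j
  proof (induction j)
    case (Suc j)
    then show ?case using F_periodic[of "int j"] step[of j N] by (simp add: add.commute)
  qed simp
  from this[of m] have "(\<Sum>i<N. F (int i + int m)) = 0"
    using assms(1) by (simp add: F_def orthogonal_to_sines_def)
  then show "(\<Sum>i<N. f (int i + int m) * sin ((real i - \<alpha>) * (pi / N)) * sin ((real i - \<beta>) * (pi / N))) = 0"
    by (simp add: F_def)
qed

lemma orthogonal_to_sines_linear: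
  assumes "orthogonal_to_sines N f" "orthogonal_to_sines N g" "orthogonal_to_sines N h"
  shows "orthogonal_to_sines N (\<lambda>i. r * f i + s * g i - h i)"
  using assms unfolding orthogonal_to_sines_def
  by (simp add: algebra_simps sum.distrib sum_subtractf sum_distrib_left[symmetric])

text \<open>The phases \<open>p + 1/2\<close> and \<open>q + 1/2\<close> place the zeros of the sines strictly between integers.\<close>

lemma orthogonal_to_sines_sign_changes:
  assumes "orthogonal_to_sines N c" "c (int N) = c 0" "N \<ge> 4"
  shows "sign_changes N c \<ge> 4"
proof (rule four_sign_changes_if_orthogonal)
  have bounds: "0 < y * (pi / N)" "y * (pi / N) < pi" if "0 < y" "y < real N" for y
    using that mult_strict_right_mono[of y N "pi / N"] by auto
  have half: "side p (int i) * sin ((real i - (p + 1 / 2)) * (pi / N)) > 0"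
    if "0 \<le> p" "p < int N" "i < N" for p i
  proof (cases "int i \<le> p")
    case True
    define t where "t = (p + 1 / 2 - real i) * (pi / N)"
    have "0 < p + 1 / 2 - real i" "p + 1 / 2 - real i < N" using True that by linarith+
    then have "0 < t" "t < pi" unfolding t_def by (rule bounds)+
    then have "sin t > 0" by (rule sin_gt_zero)
    moreover have "(real i - (p + 1 / 2)) * (pi / N) = - t" by (simp add: t_def algebra_simps)
    ultimately show ?thesis using True by (simp only: sin_minus) (simp add: side_def)
  next
    case False
    define t where "t = (real i - (p + 1 / 2)) * (pi / N)"
    have "0 < real i - (p + 1 / 2)" "real i - (p + 1 / 2) < N" using False that by linarith+
    then have "0 < t" "t < pi" unfolding t_def by (rule bounds)+
    then have "sin t > 0" by (rule sin_gt_zero)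
    then show ?thesis using False by (simp add: side_def t_def)
  qed
  fix p q :: int assume "0 \<le> p" "p < int N" "0 \<le> q" "q < int N"
  then show "\<exists>x y. (\<forall>i<N. side p (int i) * x i > 0) \<and> (\<forall>i<N. side q (int i) * y i > 0) \<and>
      (\<Sum>i<N. c (int i) * x i * y i) = 0"
    using half[of p] half[of q] assms(1) unfolding orthogonal_to_sines_def
    by (intro exI[of _ "\<lambda>i. sin ((real i - (p + 1 / 2)) * (pi / N))"]
        exI[of _ "\<lambda>i. sin ((real i - (q + 1 / 2)) * (pi / N))"]) simp
qed (use assms in simp_all)

lemmas dual_simps = zero_dual_def one_dual_def plus_dual_def minus_dual_def uminus_dual_def times_dual_def

lemma eps_part_sum: "eps_part (sum f A) = (\<Sum>i\<in>A. eps_part (f i))"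
  by (induction A rule: infinite_finite_induct) (simp_all add: dual_simps)

lemma dual_unit: "x \<noteq> 0 \<Longrightarrow> Dual x y dvd 1"
  by (rule dvdI[where k = "Dual (1 / x) (- y / x\<^sup>2)"])
    (simp add: dual_simps power2_eq_square)

text \<open>Over the dual numbers the Wronskian identity compares the solution \<open>ext p\<close> of the deformed equation
  with an arbitrary sine, a solution of the constant one. As the coefficients differ by
  \<open>\<epsilon> c\<^sub>j\<close>, only the standard part of \<open>ext p\<close> survives, and this is a sine as well. The remaining
  rows follow by induction from the linearization \<open>d_rec\<close> of the recurrence.\<close>

lemma infinitesimal_row_sign_changes:
  fixes w k :: nat
  assumes "infinitesimal_deformation w d" "k \<le> w" "w \<ge> 1"
  shows "sign_changes (w + 3) (frieze_row d k) \<ge> 4"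
proof -
  let ?N = "w + 3"
  define \<theta> where "\<theta> = pi / ?N"
  define S where "S x = sin (x * \<theta>) / sin \<theta>" for x :: real
  have \<theta>: "0 < \<theta>" "\<theta> < pi" "?N * \<theta> = pi" by (auto simp: \<theta>_def divide_less_eq)
  have sin_\<theta>: "sin \<theta> > 0" using \<theta> by (simp add: sin_gt_zero)
  have const: "const_frieze w i j = S (j - i)" for i j
    by (simp add: const_frieze_def S_def \<theta>_def)
  have S_pos: "S x > 0" if "0 < x" "x < real ?N" for x :: real
  proof -
    have "x * \<theta> < ?N * \<theta>" using that \<theta> by (intro mult_strict_right_mono) auto
    then have "x * \<theta> < pi" by (simp only: \<theta>(3))
    then have "sin (x * \<theta>) > 0" using that \<theta> by (intro sin_gt_zero) auto
    then show ?thesis using sin_\<theta> by (simp add: S_def)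
  qed
  define V where "V i j = Dual (const_frieze w i j) (d i j)" for i j
  have V: "V i j = Dual (S (j - i)) (d i j)" for i j
    by (simp add: V_def const)
  interpret V: unit_frieze w V
  proof
    show "frieze w V"
      using assms(1) by (simp add: infinitesimal_deformation_def V_def[abs_def])
    fix i j assume "i < j" "j < i + int (w + 3)"
    then have "S (j - i) > 0" by (intro S_pos) auto
    then show "V i j dvd 1" unfolding V by (intro dual_unit) simp
  qed
  have S2: "S 2 = 2 * cos \<theta>" using sin_\<theta> by (simp add: S_def sin_double)
  define c where "c j = d (j - 1) (j + 1)" for j
  have V_quiddity: "V.quiddity j = Dual (2 * cos \<theta>) (c j)" for j
    by (simp add: V.quiddity_def V S2 c_def)
  have d_border: "d i i = 0" "d i (i + 1) = 0" for i
    using V.border(1,2)[of i] by (simp_all add: V dual_simps)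
  have d_rec: "d i (j + 1) = 2 * cos \<theta> * d i j + S (j - i) * c j - d i (j - 1)"
    if "i < j" "j < i + int ?N" for i j
    using V.recurrence[OF that] by (simp add: V V_quiddity dual_simps algebra_simps)
  have c_periodic: "c (i + int ?N) = c i" for i
    using V.quiddity_periodic[of i] by (simp add: V_quiddity)
  have sines_rec: "sin ((real_of_int (j + 1) - \<beta>) * \<theta>) + sin ((real_of_int (j - 1) - \<beta>) * \<theta>)
      = 2 * cos \<theta> * sin ((real_of_int j - \<beta>) * \<theta>)" for j \<beta>
  proof -
    have "(real_of_int (j + 1) - \<beta>) * \<theta> = (real_of_int j - \<beta>) * \<theta> + \<theta>"
      "(real_of_int (j - 1) - \<beta>) * \<theta> = (real_of_int j - \<beta>) * \<theta> - \<theta>"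
      by (simp_all add: algebra_simps)
    then show ?thesis by (simp only: sin_add sin_diff) simp
  qed
  have sines_anti: "sin ((real_of_int (j + int ?N) - \<beta>) * \<theta>) = - sin ((real_of_int j - \<beta>) * \<theta>)" for j \<beta>
  proof -
    have "(real_of_int (j + int ?N) - \<beta>) * \<theta> = (real_of_int j - \<beta>) * \<theta> + ?N * \<theta>"
      by (simp add: algebra_simps)
    then show ?thesis by (simp only: \<theta>(3) sin_periodic_pi)
  qed
  \<comment> \<open>For \<open>p = 0\<close> and \<open>p = -1\<close> the summation range lies in the strip where \<open>ext p\<close> is given by the
    array itself; these two phases already span all sines.\<close>
  have wronskian: "(\<Sum>j<?N. c (int j) * sin ((real j - p) * \<theta>) * sin ((real j - \<beta>) * \<theta>)) = 0"
    if "p = 0 \<or> p = -1" for p :: int and \<beta> :: real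
  proof -
    let ?y = "\<lambda>j::int. Dual (sin ((real_of_int j - \<beta>) * \<theta>)) 0"
    have "(\<Sum>j<?N. (V.quiddity (int j) - Dual (2 * cos \<theta>) 0) * V.ext p (int j) * ?y (int j)) = 0"
    proof (rule wronskian_sum)
      fix j
      show "?y (j + 1) + ?y (j - 1) = Dual (2 * cos \<theta>) 0 * ?y j"
        using sines_rec[of j \<beta>] by (simp add: dual_simps)
      show "?y (j + int ?N) = - ?y j"
        using sines_anti[of j \<beta>] by (simp add: dual_simps)
    qed (rule V.ext_recurrence V.ext_antiperiodic)+
    then have "eps_part (\<Sum>j<?N. (V.quiddity (int j) - Dual (2 * cos \<theta>) 0) * V.ext p (int j) * ?y (int j)) = 0"
      by (simp add: zero_dual_def)
    moreover have "V.ext p (int j) = Dual (S (real j - p)) (d p (int j))" if "j < ?N" for j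
      using V.ext_eq[of p "int j"] that \<open>p = 0 \<or> p = -1\<close> by (auto simp: V)
    ultimately have "(\<Sum>j<?N. c (int j) * S (real j - p) * sin ((real j - \<beta>) * \<theta>)) = 0"
      by (simp add: eps_part_sum V_quiddity dual_simps)
    then have "(\<Sum>j<?N. c (int j) * sin ((real j - p) * \<theta>) * sin ((real j - \<beta>) * \<theta>)) / sin \<theta> = 0"
      by (simp add: S_def sum_divide_distrib)
    then show ?thesis using sin_\<theta> by simp
  qed
  have c_orthogonal: "orthogonal_to_sines ?N c"
    unfolding orthogonal_to_sines_def \<theta>_def[symmetric]
  proof (intro allI)
    fix \<alpha> \<beta> :: real
    define A where "A = cos (\<alpha> * \<theta>) + sin (\<alpha> * \<theta>) * cos \<theta> / sin \<theta>"
    define B where "B = - sin (\<alpha> * \<theta>) / sin \<theta>"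
    have combine: "sin ((x - \<alpha>) * \<theta>) = A * sin ((x - of_int 0) * \<theta>) + B * sin ((x - of_int (-1)) * \<theta>)" for x :: real
    proof -
      have e0: "(x - of_int 0) * \<theta> = x * \<theta>" by simp
      have e1: "sin ((x - of_int (-1)) * \<theta>) = sin (x * \<theta>) * cos \<theta> + cos (x * \<theta>) * sin \<theta>"
        by (simp add: algebra_simps sin_add)
      have e2: "sin ((x - \<alpha>) * \<theta>) = sin (x * \<theta>) * cos (\<alpha> * \<theta>) - cos (x * \<theta>) * sin (\<alpha> * \<theta>)"
        by (simp add: left_diff_distrib sin_diff)
      show ?thesis
        unfolding e0 e1 e2 A_def B_def using sin_\<theta> by (simp add: field_simps)
    qed
    have "(\<Sum>j<?N. c (int j) * sin ((real j - \<alpha>) * \<theta>) * sin ((real j - \<beta>) * \<theta>)) =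
        A * (\<Sum>j<?N. c (int j) * sin ((real j - of_int 0) * \<theta>) * sin ((real j - \<beta>) * \<theta>)) +
        B * (\<Sum>j<?N. c (int j) * sin ((real j - of_int (-1)) * \<theta>) * sin ((real j - \<beta>) * \<theta>))"
      unfolding combine sum_distrib_left sum.distrib[symmetric]
      by (intro sum.cong refl) (simp only: algebra_simps)
    then show "(\<Sum>j<?N. c (int j) * sin ((real j - \<alpha>) * \<theta>) * sin ((real j - \<beta>) * \<theta>)) = 0"
      using wronskian[of 0 \<beta>] wronskian[of "-1" \<beta>] by simp
  qed
  define row where "row g i = d i (i + int g)" for g :: nat and i
  define good where "good g \<longleftrightarrow> orthogonal_to_sines ?N (row g) \<and> (\<forall>i. row g (i + int ?N) = row g i)" for g
  have "g < ?N \<Longrightarrow> good g \<and> good (Suc g)" for g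
  proof (induction g)
    case 0
    have "row 0 = (\<lambda>i. 0)" "row (Suc 0) = (\<lambda>i. 0)"
      by (auto simp: row_def d_border)
    then show ?case by (simp add: good_def orthogonal_to_sines_def)
  next
    case (Suc g)
    then have IH: "good g" "good (Suc g)" by auto
    have row_rec: "row (Suc (Suc g)) i =
        2 * cos \<theta> * row (Suc g) i + S (real (Suc g)) * c (i + int (Suc g)) - row g i" for i
      using d_rec[of i "i + int (Suc g)"] Suc.prems by (simp add: row_def add_ac)
    have "orthogonal_to_sines ?N (row (Suc (Suc g)))"
      unfolding row_rec[abs_def] using IH c_periodic c_orthogonal
      by (intro orthogonal_to_sines_linear orthogonal_to_sines_shift) (simp_all add: good_def)
    moreover have "row (Suc (Suc g)) (i + int ?N) = row (Suc (Suc g)) i" for i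
      using IH c_periodic[of "i + int (Suc g)"] by (simp add: row_rec good_def add_ac)
    ultimately show ?case using IH by (simp add: good_def)
  qed
  from this[of k] have "good (Suc k)" using assms(2) by simp
  moreover have "frieze_row d k = row (Suc k)"
    by (simp add: frieze_row_def row_def fun_eq_iff add_ac)
  ultimately show ?thesis
    using orthogonal_to_sines_sign_changes[of ?N "row (Suc k)"] assms(3)
    by (auto simp: good_def dest: spec[of _ 0])
qed

theorem mainTheorem1:
  fixes w k :: nat
  assumes "w \<ge> 1" and "1 \<le> k" and "k \<le> w div 2"
  shows "(\<forall>v u :: int \<Rightarrow> int \<Rightarrow> real.
            positive_frieze w v \<and> positive_frieze w u \<and> (k = 1 \<or> k = 2) \<longrightarrow>
              sign_changes (w + 3) (\<lambda>i. frieze_row v k i - frieze_row u k i) \<ge> 4) \<and>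
         (\<forall>d :: int \<Rightarrow> int \<Rightarrow> real.
            infinitesimal_deformation w d \<longrightarrow> sign_changes (w + 3) (frieze_row d k) \<ge> 4)"
proof (intro conjI allI impI)
  fix v u :: "int \<Rightarrow> int \<Rightarrow> real"
  assume vu: "positive_frieze w v \<and> positive_frieze w u \<and> (k = 1 \<or> k = 2)"
  \<comment> \<open>Translation by \<open>k\<close> aligns \<open>v\<^bsub>i,i+k+1\<^esub>\<close> with the rows \<open>v\<^bsub>i-1,i+1\<^esub>\<close> and \<open>v\<^bsub>i-2,i+1\<^esub>\<close> of the two lemmas.\<close>
  then have shifted: "positive_frieze w (\<lambda>i j. v (i + int k) (j + int k))"
    "positive_frieze w (\<lambda>i j. u (i + int k) (j + int k))"
    by (auto intro: positive_frieze_shift)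
  from vu have "k = 1 \<or> k = 2" by simp
  then show "sign_changes (w + 3) (\<lambda>i. frieze_row v k i - frieze_row u k i) \<ge> 4"
    using first_row_difference[OF shifted assms(1)] second_row_difference[OF shifted assms(1)]
    by (auto simp: frieze_row_def algebra_simps)
next
  fix d assume "infinitesimal_deformation w d"
  then show "sign_changes (w + 3) (frieze_row d k) \<ge> 4"
    using infinitesimal_row_sign_changes[of w d k] assms by auto
qed

end
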